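(* Let $E$ be a (real or complex) Banach space and suppose that $\mathcal{F}=((a_n,b_n^* ))_{n\in\mathbb{N}^*}\subset E\times E^*$ is a Besselian Schauder frame for $E$. Then $E$ has property (u).
   Context: A sequence $((a_n,b_n^* ))_{n\in\mathbb{N}^*}$ in $E\times E^*$ is a Besselian Schauder frame for $E$ if (i) for every $x\in E$ the series $\sum_n b_n^*(x)a_n$ converges in norm to $x$, and (ii) there is $B>0$ with $\sum_{n=1}^\infty|b_n^*(x)||y^*(a_n)|\le B\|x\|_E\|y^*\|_{E^*}$ for all $x\in E$, $y^*\in E^*$. A sequence $(x_n)$ in $E$ is weakly Cauchy if $\lim_n y^*(x_n)$ exists for every $y^*\in E^*$. A series $\sum_n u_n$ in $E$ is weakly unconditionally Cauchy (WUC) if $\sum_n|y^*(u_n)|<\infty$ for every $y^*\in E^*$. $E$ has property (u) if for every weakly Cauchy sequence $(x_n)$ in $E$ there is a WUC series $\sum_k u_k$ in $E$ such that $x_n-\sum_{k=1}^n u_k\to0$ weakly. *)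

theory Defs
  imports "HOL-Analysis.Analysis"
begin

(* Banach spaces over a normed scalar field 'k, used below for 'k = real and 'k = complex.
   The class banach supplies the norm, completeness and the real vector space
   structure; smul is the scalar multiplication of 'k and must extend the real one. *)
locale banach_space_over = vector_space smul
  for smul :: "'k::real_normed_field \<Rightarrow> 'e::banach \<Rightarrow> 'e" +
  assumes norm_smul: "norm (smul c x) = norm c * norm x"
    and smul_of_real: "smul (of_real r) x = r *\<^sub>R x"

lemma banach_space_over_scaleR: "banach_space_over (scaleR :: real \<Rightarrow> 'e::banach \<Rightarrow> 'e)"
  by unfold_locales (simp_all add: algebra_simps)

(* Elements of the type of bounded linear maps are only real-linear, hence the homogeneity
   condition. The library's operator norm on this type restricts to the usual dual norm. *)
definition dual :: "('k::real_normed_field \<Rightarrow> 'e::banach \<Rightarrow> 'e) \<Rightarrow> ('e \<Rightarrow>\<^sub>L 'k) set" where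
  "dual smul = {f. \<forall>c x. blinfun_apply f (smul c x) = c * blinfun_apply f x}"

lemma dual_scaleR: "dual (scaleR :: real \<Rightarrow> 'e::banach \<Rightarrow> 'e) = UNIV"
  by (auto simp: dual_def blinfun.scaleR_right)

(* All sequences are indexed from 0 instead of 1. *)

definition besselian_schauder_frame ::
  "('k::real_normed_field \<Rightarrow> 'e::banach \<Rightarrow> 'e) \<Rightarrow> (nat \<Rightarrow> 'e) \<Rightarrow> (nat \<Rightarrow> 'e \<Rightarrow>\<^sub>L 'k) \<Rightarrow> bool" where
  "besselian_schauder_frame smul a b \<longleftrightarrow>
     (\<forall>n. b n \<in> dual smul) \<and>
     (\<forall>x. (\<lambda>n. smul (blinfun_apply (b n) x) (a n)) sums x) \<and>
     (\<exists>B>0. \<forall>x. \<forall>y\<in>dual smul.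
        summable (\<lambda>n. norm (blinfun_apply (b n) x) * norm (blinfun_apply y (a n))) \<and>
        (\<Sum>n. norm (blinfun_apply (b n) x) * norm (blinfun_apply y (a n))) \<le> B * norm x * norm y)"

definition weakly_Cauchy ::
  "('k::real_normed_field \<Rightarrow> 'e::banach \<Rightarrow> 'e) \<Rightarrow> (nat \<Rightarrow> 'e) \<Rightarrow> bool" where
  "weakly_Cauchy smul x \<longleftrightarrow> (\<forall>y\<in>dual smul. convergent (\<lambda>n. blinfun_apply y (x n)))"

definition weakly_tendsto ::
  "('k::real_normed_field \<Rightarrow> 'e::banach \<Rightarrow> 'e) \<Rightarrow> (nat \<Rightarrow> 'e) \<Rightarrow> 'e \<Rightarrow> bool" where
  "weakly_tendsto smul x l \<longleftrightarrow>
     (\<forall>y\<in>dual smul. (\<lambda>n. blinfun_apply y (x n)) \<longlonglongrightarrow> blinfun_apply y l)"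

definition weakly_unconditionally_Cauchy ::
  "('k::real_normed_field \<Rightarrow> 'e::banach \<Rightarrow> 'e) \<Rightarrow> (nat \<Rightarrow> 'e) \<Rightarrow> bool" where
  "weakly_unconditionally_Cauchy smul u \<longleftrightarrow>
     (\<forall>y\<in>dual smul. summable (\<lambda>n. norm (blinfun_apply y (u n))))"

definition property_u :: "('k::real_normed_field \<Rightarrow> 'e::banach \<Rightarrow> 'e) \<Rightarrow> bool" where
  "property_u smul \<longleftrightarrow>
     (\<forall>x. weakly_Cauchy smul x \<longrightarrow>
        (\<exists>u. weakly_unconditionally_Cauchy smul u \<and>
             weakly_tendsto smul (\<lambda>n. x n - (\<Sum>k\<le>n. u k)) 0))"

end

theory Submission imports Defs begin

text \<open>Let \<open>x\<^sub>n\<close> be weakly Cauchy, \<open>\<beta>\<^sub>k = lim\<^sub>n b\<^sub>k(x\<^sub>n)\<close> and \<open>u\<^sub>k = \<beta>\<^sub>k a\<^sub>k\<close>. For a functional \<open>y\<close> and a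
  bounded scalar sequence \<open>\<epsilon>\<close>, the Besselian estimate makes \<open>x \<mapsto> \<Sum>\<^sub>k \<epsilon>\<^sub>k b\<^sub>k(x) y(a\<^sub>k)\<close> a bounded
  functional, so its values along \<open>x\<^sub>n\<close> converge. Hence the sequences \<open>v\<^sub>n = (b\<^sub>k(x\<^sub>n) y(a\<^sub>k))\<^sub>k\<close>
  are weakly Cauchy in \<open>\<ell>\<^sup>1\<close>, and by Schur's theorem they converge in norm, necessarily to
  \<open>(y(u\<^sub>k))\<^sub>k\<close>. This limit is absolutely summable, and summing over \<open>k\<close> gives
  \<open>y(x\<^sub>n) \<rightarrow> \<Sum>\<^sub>k y(u\<^sub>k)\<close>.\<close>

text \<open>This quotient is the factor that rotates \<open>z\<close> to the positive axis. At
  \<open>z = 0\<close> it is 0 by the division convention, hence an inequality.\<close>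

lemma norm_of_real_norm_divide_le: "norm (of_real (norm z) / z) \<le> 1"
  for z :: "'k::real_normed_field"
  by (cases "z = 0") (simp_all add: norm_divide)

lemma summable_bounded_mult:
  fixes w \<epsilon> :: "nat \<Rightarrow> 'k::{real_normed_field,banach}"
  assumes "summable (\<lambda>k. norm (w k))" "\<And>k. norm (\<epsilon> k) \<le> 1"
  shows "summable (\<lambda>k. \<epsilon> k * w k)"
proof (rule summable_comparison_test'[OF assms(1)])
  show "norm (\<epsilon> k * w k) \<le> norm (w k)" for k
    using mult_right_mono[OF assms(2)[of k] norm_ge_zero[of "w k"]] by (simp add: norm_mult)
qed

text \<open>The proof is a gliding hump: along a subsequence, most of the mass of \<open>w\<close> sits on
  consecutive disjoint blocks, and \<open>\<epsilon>\<close> rotates the entries of each block to the positive axis.\<close>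

lemma schur_l1_null:
  fixes w :: "nat \<Rightarrow> nat \<Rightarrow> 'k::{real_normed_field,banach}"
  assumes sm: "\<And>n. summable (\<lambda>k. norm (w n k))"
    and null: "\<And>\<epsilon>. (\<And>k. norm (\<epsilon> k) \<le> 1) \<Longrightarrow> (\<lambda>n. \<Sum>k. \<epsilon> k * w n k) \<longlonglongrightarrow> 0"
  shows "(\<lambda>n. \<Sum>k. norm (w n k)) \<longlonglongrightarrow> 0"
proof (rule ccontr)
  assume "\<not> ?thesis"
  then obtain \<delta> where \<delta>: "\<delta> > 0" and "\<And>M. \<exists>n\<ge>M. norm ((\<Sum>k. norm (w n k)) - 0) \<ge> \<delta>"
    unfolding LIMSEQ_iff by (meson not_less)
  then have big: "\<exists>n\<ge>M. (\<Sum>k. norm (w n k)) \<ge> \<delta>" for M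
    by (simp add: suminf_nonneg sm)
  have coord: "(\<lambda>n. w n k) \<longlonglongrightarrow> 0" for k
  proof -
    \<comment> \<open>The test sequence is the \<open>k\<close>-th unit vector.\<close>
    have "(\<lambda>n. \<Sum>i. (if i = k then 1 else 0) * w n i) \<longlonglongrightarrow> 0"
      by (rule null) simp
    moreover have "(\<Sum>i. (if i = k then 1 else 0) * w n i) = w n k" for n
    proof -
      have "(\<lambda>i. (if i = k then 1 else 0) * w n i) = (\<lambda>i. if i = k then w n i else 0)"
        by auto
      then show ?thesis
        using sums_single[of k "w n"] by (simp add: sums_iff)
    qed
    ultimately show ?thesis by simp
  qed
  \<comment> \<open>The head below \<open>N\<close> is small for late rows by \<open>coord\<close>,
    the tail beyond a late \<open>N'\<close> by summability of the chosen row. Head and tail will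
    each cost twice their mass, so the bound \<delta>/5 for each leaves \<delta>/5 of the total
    \<delta>.\<close>
  have step: "\<exists>n N'. n \<ge> i \<and> N' > N \<and> (\<Sum>k. norm (w n k)) \<ge> \<delta> \<and>
      (\<Sum>k<N. norm (w n k)) < \<delta>/5 \<and> (\<Sum>k. norm (w n (k + N'))) < \<delta>/5" for i N
  proof -
    have "(\<lambda>n. \<Sum>k<N. norm (w n k)) \<longlonglongrightarrow> (\<Sum>k<N. 0)"
      by (intro tendsto_sum tendsto_norm_zero coord)
    then have "\<forall>\<^sub>F n in sequentially. (\<Sum>k<N. norm (w n k)) < \<delta>/5"
      using \<delta> by (intro order_tendstoD) auto
    then obtain M where M: "\<And>n. n \<ge> M \<Longrightarrow> (\<Sum>k<N. norm (w n k)) < \<delta>/5"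
      by (auto simp: eventually_sequentially)
    obtain n where n: "n \<ge> max i M" "(\<Sum>k. norm (w n k)) \<ge> \<delta>"
      using big by blast
    have "(\<lambda>N'. \<Sum>k. norm (w n (k + N'))) \<longlonglongrightarrow> 0"
      by (rule suminf_exist_split2[OF sm])
    then have "\<forall>\<^sub>F N' in sequentially. (\<Sum>k. norm (w n (k + N'))) < \<delta>/5 \<and> N' > N"
      using \<delta> by (intro eventually_conj order_tendstoD eventually_gt_at_top) auto
    then obtain N' where "(\<Sum>k. norm (w n (k + N'))) < \<delta>/5" "N' > N"
      using eventually_happens by fastforce
    with n M show ?thesis by auto
  qed
  then obtain J F where JF: "\<And>i N. J i N \<ge> i" "\<And>i N. F i N > N"
      "\<And>i N. (\<Sum>k. norm (w (J i N) k)) \<ge> \<delta>"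
      "\<And>i N. (\<Sum>k<N. norm (w (J i N) k)) < \<delta>/5"
      "\<And>i N. (\<Sum>k. norm (w (J i N) (k + F i N))) < \<delta>/5"
    by metis
  \<comment> \<open>Block \<open>i\<close> runs from \<open>P i\<close> up to, but excluding,
    \<open>P (Suc i)\<close>. Row \<open>j i\<close> has all but 2\<delta>/5 of its mass
    there.\<close>
  define P where "P = rec_nat 0 F"
  define j where "j i = J i (P i)" for i
  have P_Suc: "P (Suc i) = F i (P i)" for i
    by (simp add: P_def)
  have "strict_mono P"
    by (rule strict_monoI_Suc) (simp add: P_Suc JF)
  then have "mono P"
    by (rule strict_mono_mono)
  \<comment> \<open>The index of the block that contains \<open>k\<close>. The blocks cover all
    indices, as \<open>P\<close> increases strictly from 0.\<close>
  define I where "I k = (LEAST i. k < P (Suc i))" for k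
  define \<epsilon> where "\<epsilon> k = of_real (norm (w (j (I k)) k)) / w (j (I k)) k" for k
  have I: "I k = i" if "P i \<le> k" "k < P (Suc i)" for i k
    unfolding I_def
  proof (rule Least_equality)
    show "i \<le> i'" if "k < P (Suc i')" for i'
      using that \<open>P i \<le> k\<close> monoD[OF \<open>mono P\<close>, of "Suc i'" i] by (meson leD leI le_trans not_less_eq_eq)
  qed fact
  have \<epsilon>_le: "norm (\<epsilon> k) \<le> 1" for k
    unfolding \<epsilon>_def by (rule norm_of_real_norm_divide_le)
  have lower: "norm (\<Sum>k. \<epsilon> k * w (j i) k) \<ge> \<delta>/5" for i
  proof -
    define z where "z = w (j i)"
    \<comment> \<open>The error made by using \<open>\<epsilon>\<close> in place of the rotation
      belonging to row \<open>j i\<close> alone. It vanishes on block \<open>i\<close>, so only the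
      head and the tail contribute to its sum.\<close>
    define h where "h k = of_real (norm (z k)) - \<epsilon> k * z k" for k
    have sz: "summable (\<lambda>k. norm (z k))"
      unfolding z_def by (rule sm)
    have h_le: "norm (h k) \<le> 2 * norm (z k)" for k
    proof -
      have "norm (h k) \<le> norm (z k) + norm (\<epsilon> k) * norm (z k)"
        unfolding h_def by (metis norm_mult norm_of_real abs_norm_cancel norm_triangle_ineq4)
      also have "\<dots> \<le> norm (z k) + 1 * norm (z k)"
        by (intro add_left_mono mult_right_mono \<epsilon>_le) simp
      finally show ?thesis by simp
    qed
    have h_zero: "h k = 0" if "P i \<le> k" "k < P (Suc i)" for k
      by (simp add: h_def \<epsilon>_def I[OF that] z_def)
    have snh: "summable (\<lambda>k. norm (h k))"
      by (rule summable_comparison_test'[OF summable_mult[OF sz, of 2]]) (simp add: h_le)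
    then have sh: "summable h"
      by (rule summable_norm_cancel)
    have "(\<Sum>k. h k) = of_real (\<Sum>k. norm (z k)) - (\<Sum>k. \<epsilon> k * z k)"
      unfolding h_def using suminf_diff[OF summable_of_real[OF sz] summable_bounded_mult[OF sz \<epsilon>_le]]
      by (simp add: suminf_of_real[OF sz])
    then have "norm (\<Sum>k. \<epsilon> k * z k) \<ge> norm (of_real (\<Sum>k. norm (z k)) :: 'k) - norm (\<Sum>k. h k)"
      by (metis add_diff_cancel_left' diff_add_cancel norm_triangle_ineq2 norm_minus_commute)
    moreover have "norm (of_real (\<Sum>k. norm (z k)) :: 'k) \<ge> \<delta>"
      using JF(3)[of i "P i"] by (simp add: z_def j_def)
    moreover have "norm (\<Sum>k. h k) \<le> 4 * \<delta> / 5"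
    proof -
      have "norm (\<Sum>k. h k) = norm ((\<Sum>k. h (k + P (Suc i))) + (\<Sum>k<P (Suc i). h k))"
        using suminf_split_initial_segment[OF sh] by simp
      also have "(\<Sum>k<P (Suc i). h k) = (\<Sum>k<P i. h k)"
        using monoD[OF \<open>mono P\<close>, of i "Suc i"]
        by (intro sum.mono_neutral_right) (auto intro!: h_zero)
      also have "norm ((\<Sum>k. h (k + P (Suc i))) + (\<Sum>k<P i. h k))
          \<le> (\<Sum>k. norm (h (k + P (Suc i)))) + (\<Sum>k<P i. norm (h k))"
        by (intro norm_triangle_mono summable_norm norm_sum summable_ignore_initial_segment[OF snh])
      also have "\<dots> \<le> (\<Sum>k. 2 * norm (z (k + P (Suc i)))) + (\<Sum>k<P i. 2 * norm (z k))"
        by (intro add_mono suminf_le sum_mono h_le summable_mult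
            summable_ignore_initial_segment[OF snh] summable_ignore_initial_segment[OF sz])
      also have "\<dots> = 2 * (\<Sum>k. norm (z (k + P (Suc i)))) + 2 * (\<Sum>k<P i. norm (z k))"
        by (simp add: suminf_mult summable_ignore_initial_segment[OF sz] sum_distrib_left)
      also have "\<dots> \<le> 4 * \<delta> / 5"
        using JF(4)[of i "P i"] JF(5)[of i "P i"] by (simp add: z_def j_def P_Suc)
      finally show ?thesis .
    qed
    ultimately show ?thesis unfolding z_def by simp
  qed
  have "(\<lambda>n. \<Sum>k. \<epsilon> k * w n k) \<longlonglongrightarrow> 0"
    by (rule null) (rule \<epsilon>_le)
  then obtain M where "\<And>n. n \<ge> M \<Longrightarrow> norm (\<Sum>k. \<epsilon> k * w n k) < \<delta>/5"
    using \<delta> unfolding LIMSEQ_iff by (metis diff_zero divide_pos_pos zero_less_numeral)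
  then show False
    using lower[of M] JF(1)[of M "P M"] by (fastforce simp: j_def)
qed

text \<open>Differences of late rows are weakly null, so \<open>schur_l1_null\<close> makes the rows
  Cauchy in norm. The norm limit must agree with the coordinatewise limit \<open>l\<close>.\<close>

lemma schur_l1:
  fixes v :: "nat \<Rightarrow> nat \<Rightarrow> 'k::{real_normed_field,banach}"
  assumes sm: "\<And>n. summable (\<lambda>k. norm (v n k))"
    and conv: "\<And>\<epsilon>. (\<And>k. norm (\<epsilon> k) \<le> 1) \<Longrightarrow> convergent (\<lambda>n. \<Sum>k. \<epsilon> k * v n k)"
    and lim: "\<And>k. (\<lambda>n. v n k) \<longlonglongrightarrow> l k"
  shows "summable (\<lambda>k. norm (l k))" "(\<lambda>n. \<Sum>k. v n k) \<longlonglongrightarrow> (\<Sum>k. l k)"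
proof -
  have sd: "summable (\<lambda>k. norm (v m k - v n k))" for m n
    by (rule summable_comparison_test'[OF summable_add[OF sm[of m] sm[of n]]])
      (simp add: norm_triangle_ineq4)
  have cauchy: "\<exists>M. \<forall>m\<ge>M. \<forall>n\<ge>M. (\<Sum>k. norm (v m k - v n k)) < e" if "e > 0" for e
  proof (rule ccontr)
    assume "\<not> ?thesis"
    then have "\<forall>M. \<exists>m n. m \<ge> M \<and> n \<ge> M \<and> (\<Sum>k. norm (v m k - v n k)) \<ge> e"
      by (meson not_less)
    then obtain p q where pq: "\<And>M. p M \<ge> M" "\<And>M. q M \<ge> M"
        "\<And>M. (\<Sum>k. norm (v (p M) k - v (q M) k)) \<ge> e"
      by metis
    \<comment> \<open>Both \<open>p M\<close> and \<open>q M\<close> tend to infinity, so against a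
      fixed \<open>\<epsilon>\<close> the two rows have the same limit \<open>L\<close>.\<close>
    have "(\<lambda>M. \<Sum>k. norm (v (p M) k - v (q M) k)) \<longlonglongrightarrow> 0"
    proof (rule schur_l1_null[OF sd])
      fix \<epsilon> :: "nat \<Rightarrow> 'k" assume \<epsilon>: "\<And>k. norm (\<epsilon> k) \<le> 1"
      define g where "g n = (\<Sum>k. \<epsilon> k * v n k)" for n
      obtain L where L: "g \<longlonglongrightarrow> L"
        using conv[of \<epsilon>, OF \<epsilon>] unfolding convergent_def g_def by blast
      have "filterlim p sequentially sequentially" "filterlim q sequentially sequentially"
        using pq by (auto intro!: filterlim_at_top_mono[OF filterlim_ident])
      then have "(\<lambda>M. g (p M) - g (q M)) \<longlonglongrightarrow> L - L"
        by (intro tendsto_diff filterlim_compose[OF L])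
      moreover have "(\<Sum>k. \<epsilon> k * (v m k - v n k)) = g m - g n" for m n
        unfolding g_def right_diff_distrib
        by (intro suminf_diff[symmetric] summable_bounded_mult[OF sm \<epsilon>])
      ultimately show "(\<lambda>M. \<Sum>k. \<epsilon> k * (v (p M) k - v (q M) k)) \<longlonglongrightarrow> 0"
        by simp
    qed
    then have "\<forall>\<^sub>F M in sequentially. (\<Sum>k. norm (v (p M) k - v (q M) k)) < e"
      using that by (rule order_tendstoD)
    then show False
      using pq(3) by (auto simp: eventually_sequentially not_less[symmetric])
  qed
  have close: "\<exists>M. \<forall>m\<ge>M. summable (\<lambda>k. norm (v m k - l k)) \<and> (\<Sum>k. norm (v m k - l k)) \<le> e"
    if "e > 0" for e
  proof -
    obtain M where M: "\<And>m n. m \<ge> M \<Longrightarrow> n \<ge> M \<Longrightarrow> (\<Sum>k. norm (v m k - v n k)) < e"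
      using cauchy[OF \<open>e > 0\<close>] by blast
    \<comment> \<open>Letting \<open>n\<close> tend to infinity is harmless in a finite sum. The
      bound does not depend on \<open>K\<close>, so it yields both summability and the estimate of
      the full sum.\<close>
    have part: "(\<Sum>k<K. norm (v m k - l k)) \<le> e" if m: "m \<ge> M" for m K
    proof (rule LIMSEQ_le_const2)
      show "(\<lambda>n. \<Sum>k<K. norm (v m k - v n k)) \<longlonglongrightarrow> (\<Sum>k<K. norm (v m k - l k))"
        by (intro tendsto_intros lim)
      have "(\<Sum>k<K. norm (v m k - v n k)) \<le> e" if "n \<ge> M" for n
        using sum_le_suminf[OF sd[of m n], of "{..<K}"] M[OF m that] by simp
      then show "\<exists>N. \<forall>n\<ge>N. (\<Sum>k<K. norm (v m k - v n k)) \<le> e"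
        by blast
    qed
    have "summable (\<lambda>k. norm (v m k - l k))" if "m \<ge> M" for m
      using part[OF that] by (intro summableI_nonneg_bounded) auto
    then show ?thesis
      using part by (blast intro: suminf_le_const)
  qed
  obtain m where "summable (\<lambda>k. norm (v m k - l k))"
    using close[of 1] by auto
  from summable_add[OF this sm[of m]] show sl: "summable (\<lambda>k. norm (l k))"
    by (rule summable_comparison_test')
      (metis abs_norm_cancel add.commute norm_minus_commute norm_triangle_sub real_norm_def)
  show "(\<lambda>n. \<Sum>k. v n k) \<longlonglongrightarrow> (\<Sum>k. l k)"
  proof (rule LIMSEQ_I)
    fix e :: real assume "e > 0"
    then obtain M where M: "\<And>m. m \<ge> M \<Longrightarrow> summable (\<lambda>k. norm (v m k - l k))"
        "\<And>m. m \<ge> M \<Longrightarrow> (\<Sum>k. norm (v m k - l k)) \<le> e/2"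
      using close[of "e/2"] by auto
    have "norm ((\<Sum>k. v m k) - (\<Sum>k. l k)) < e" if "m \<ge> M" for m
    proof -
      have "(\<Sum>k. v m k) - (\<Sum>k. l k) = (\<Sum>k. v m k - l k)"
        by (intro suminf_diff summable_norm_cancel[OF sm] summable_norm_cancel[OF sl])
      then show ?thesis
        using summable_norm[OF M(1)[OF that]] M(2)[OF that] \<open>e > 0\<close> by simp
    qed
    then show "\<exists>M. \<forall>m\<ge>M. norm ((\<Sum>k. v m k) - (\<Sum>k. l k)) < e"
      by blast
  qed
qed

text \<open>A general complete scalar field lets one argument serve the real and the complex
  case.\<close>

theorem besselian_schauder_frame_property_u:
  fixes smul :: "'k::{real_normed_field,banach} \<Rightarrow> 'e::banach \<Rightarrow> 'e"
    and a :: "nat \<Rightarrow> 'e" and b :: "nat \<Rightarrow> 'e \<Rightarrow>\<^sub>L 'k"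
  assumes frame: "besselian_schauder_frame smul a b"
  shows "property_u smul"
  unfolding property_u_def
proof (intro allI impI)
  fix x assume wC: "weakly_Cauchy smul x"
  from frame have b_dual: "b k \<in> dual smul"
    and expand: "(\<lambda>k. smul (b k z) (a k)) sums z" for k z
    by (auto simp: besselian_schauder_frame_def)
  obtain B where "\<forall>z. \<forall>y\<in>dual smul. summable (\<lambda>k. norm (b k z) * norm (blinfun_apply y (a k))) \<and>
      (\<Sum>k. norm (b k z) * norm (blinfun_apply y (a k))) \<le> B * norm z * norm y"
    using frame unfolding besselian_schauder_frame_def by (elim conjE exE) (rule that)
  then have B: "summable (\<lambda>k. norm (b k z) * norm (y (a k)))"
      "(\<Sum>k. norm (b k z) * norm (y (a k))) \<le> B * norm z * norm y"
    if "y \<in> dual smul" for z and y :: "'e \<Rightarrow>\<^sub>L 'k"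
    using that by simp_all
  have dual_smul: "y (smul c z) = c * y z" if "y \<in> dual smul" for c z and y :: "'e \<Rightarrow>\<^sub>L 'k"
    using that by (simp add: dual_def)
  define \<beta> where "\<beta> k = lim (\<lambda>n. b k (x n))" for k
  define u where "u k = smul (\<beta> k) (a k)" for k
  \<comment> \<open>Each \<open>b k\<close> is itself a functional in the dual, so weak Cauchyness
    applies to it.\<close>
  have \<beta>: "(\<lambda>n. b k (x n)) \<longlonglongrightarrow> \<beta> k" for k
    using wC b_dual unfolding weakly_Cauchy_def \<beta>_def convergent_LIMSEQ_iff by blast
  have main: "summable (\<lambda>k. norm (y (u k)))" "(\<lambda>n. y (x n)) \<longlonglongrightarrow> (\<Sum>k. y (u k))"
    if y: "y \<in> dual smul" for y :: "'e \<Rightarrow>\<^sub>L 'k"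
  proof -
    define v where "v n k = b k (x n) * y (a k)" for n k
    have sv: "summable (\<lambda>k. norm (b k z * y (a k)))" for z
      using B(1)[OF y] by (simp add: norm_mult)
    have "convergent (\<lambda>n. \<Sum>k. \<epsilon> k * v n k)" if \<epsilon>: "\<And>k. norm (\<epsilon> k) \<le> 1" for \<epsilon>
    proof -
      define f where "f z = (\<Sum>k. \<epsilon> k * (b k z * y (a k)))" for z
      have sf: "summable (\<lambda>k. \<epsilon> k * (b k z * y (a k)))" for z
        by (rule summable_bounded_mult[OF sv \<epsilon>])
      have "bounded_linear f"
      proof (rule bounded_linear_intro)
        show "f (z + z') = f z + f z'" for z z'
          unfolding f_def suminf_add[OF sf sf]
          by (simp add: blinfun.add_right algebra_simps)
        show "f (r *\<^sub>R z) = r *\<^sub>R f z" for r z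
          unfolding f_def suminf_scaleR_right[OF sf]
          by (simp add: blinfun.scaleR_right)
        show "norm (f z) \<le> norm z * (B * norm y)" for z
        proof -
          have le: "norm (\<epsilon> k * (b k z * y (a k))) \<le> norm (b k z) * norm (y (a k))" for k
            using mult_right_mono[OF \<epsilon>[of k], of "norm (b k z) * norm (y (a k))"]
            by (simp add: norm_mult)
          have "norm (f z) \<le> (\<Sum>k. norm (b k z) * norm (y (a k)))"
            unfolding f_def by (rule norm_suminf_le[OF le B(1)[OF y]])
          also have "\<dots> \<le> B * norm z * norm y"
            by (rule B(2)[OF y])
          finally show ?thesis by (simp add: mult_ac)
        qed
      qed
      then have app: "Blinfun f z = f z" for z
        by (simp add: bounded_linear_Blinfun_apply)
      \<comment> \<open>\<open>bounded_linear\<close> covers real scalars only, while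
        \<open>dual smul\<close> asks for homogeneity over the whole field.\<close>
      have "f (smul c z) = c * f z" for c z
        unfolding f_def suminf_mult[OF sf, symmetric]
        by (simp add: dual_smul b_dual mult_ac)
      then have "Blinfun f \<in> dual smul"
        by (simp add: dual_def app)
      then have "convergent (\<lambda>n. Blinfun f (x n))"
        using wC unfolding weakly_Cauchy_def by blast
      then show ?thesis
        by (simp add: app f_def v_def)
    qed
    moreover have "(\<lambda>n. v n k) \<longlonglongrightarrow> y (u k)" for k
      unfolding v_def u_def dual_smul[OF y] by (intro tendsto_mult_right \<beta>)
    \<comment> \<open>Applying \<open>y\<close> to the frame expansion of \<open>x n\<close>
      identifies the row sums, so norm convergence of the rows gives the limit of
      \<open>y (x n)\<close>.\<close>
    moreover have "(\<Sum>k. v n k) = y (x n)" for n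
      using bounded_linear.sums[OF blinfun.bounded_linear_right expand, of y "x n"]
      by (simp add: dual_smul[OF y] v_def sums_iff)
    ultimately show "summable (\<lambda>k. norm (y (u k)))" "(\<lambda>n. y (x n)) \<longlonglongrightarrow> (\<Sum>k. y (u k))"
      using schur_l1[of v "\<lambda>k. y (u k)"] sv by (simp_all add: v_def)
  qed
  \<comment> \<open>Both \<open>y (x n)\<close> and the partial sums of \<open>y (u k)\<close> tend
    to the sum of the series, so their difference vanishes in the limit.\<close>
  have "(\<lambda>n. y (x n - (\<Sum>k\<le>n. u k))) \<longlonglongrightarrow> y 0" if y: "y \<in> dual smul" for y :: "'e \<Rightarrow>\<^sub>L 'k"
    using tendsto_diff[OF main(2)[OF y] summable_LIMSEQ'[OF summable_norm_cancel[OF main(1)[OF y]]]]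
    by (simp add: blinfun.diff_right blinfun.sum_right blinfun.zero_right)
  then show "\<exists>u. weakly_unconditionally_Cauchy smul u \<and>
      weakly_tendsto smul (\<lambda>n. x n - (\<Sum>k\<le>n. u k)) 0"
    using main(1) unfolding weakly_unconditionally_Cauchy_def weakly_tendsto_def by blast
qed

theorem theorem7:
  fixes a :: "nat \<Rightarrow> 'e::banach" and b :: "nat \<Rightarrow> 'e \<Rightarrow>\<^sub>L real"
    and scaleC :: "complex \<Rightarrow> 'f::banach \<Rightarrow> 'f"
    and c :: "nat \<Rightarrow> 'f" and d :: "nat \<Rightarrow> 'f \<Rightarrow>\<^sub>L complex"
  shows "(besselian_schauder_frame scaleR a b \<longrightarrow> property_u (scaleR :: real \<Rightarrow> 'e \<Rightarrow> 'e)) \<and>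
         (banach_space_over scaleC \<and> besselian_schauder_frame scaleC c d \<longrightarrow> property_u scaleC)"
  by (auto intro: besselian_schauder_frame_property_u)

end
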